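(* Let $X,Y$ be non-trivial complex Banach spaces and let $I=\mathbb{R}$ or $I=[0,\infty)$. The following holds in each of two versions, the "equi-Weyl" version and the "Weyl" version. Suppose that: (i) $f\in e\text{-}W_{ap,\mathbf K}^{p}(I\times Y:X)$ in the equi-Weyl version, respectively $f\in W_{ap,\mathbf K}^{p}(I\times Y:X)$ in the Weyl version, with $1<p<\infty$, and there exist a number $r\ge\max\left(p,\frac{p}{p-1}\right)$ and a function $L_f\in L_S^{r}(I)$ such that $$\|f(t,x)-f(t,y)\|\le L_f(t)\,\|x-y\|_Y,\qquad t\in I,\ x,y\in Y.$$ (ii) $x\in e\text{-}W_{ap}^{p}(I:Y)$ in the equi-Weyl version, respectively $x\in W_{ap}^{p}(I:Y)$ in the Weyl version, and there exists a set $E\subseteq I$ of Lebesgue measure $0$ such that $K:=\{x(t):t\in I\setminus E\}$ is relatively compact in $Y$. (iii) Consider the two inequalities $$\sup_{t\in I,\,u\in K}\left[\frac1l\int_t^{t+l}\|f(s+\tau,u)-f(s,u)\|^p\,ds\right]^{1/p}\le\epsilon\qquad(\ast)$$ and $$\sup_{t\in I}\left[\frac1l\int_t^{t+l}\|x(s+\tau)-x(s)\|_Y^p\,ds\right]^{1/p}\le\epsilon.\qquad(\ast\ast)$$ In the equi-Weyl version: for every $\epsilon>0$ there exist $l>0$ and $L>0$ such that any interval $I'\subseteq I$ of length $L$ contains a number $\tau\in I'$ such that $(\ast)$ and $(\ast\ast)$ hold. In the Weyl version: for every $\epsilon>0$ there exists a finite number $L>0$ such that any interval $I'\subseteq I$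 of length $L$ contains a number $\tau\in I'$ for which there exists a number $l(\epsilon,\tau)>0$ such that $(\ast)$ and $(\ast\ast)$ hold for all $l\ge l(\epsilon,\tau)$. Then $q:=\frac{pr}{p+r}\in[1,p)$, and $f(\cdot,x(\cdot))\in e\text{-}W_{ap}^{q}(I:X)$ in the equi-Weyl version, respectively $f(\cdot,x(\cdot))\in W_{ap}^{q}(I:X)$ in the Weyl version.
   Context: Let $Z$ denote an arbitrary complex Banach space and $1\le p<\infty$. **Stepanov bounded functions.** $L_S^{p}(I:Z)$ is the space of all $f\in L^p_{loc}(I:Z)$ with $\|f\|_{S^p}:=\sup_{t\in I}\left(\int_t^{t+1}\|f(s)\|^p\,ds\right)^{1/p}<\infty$; $L_S^{r}(I):=L_S^{r}(I:\mathbb{C})$. **(Equi-)Weyl almost periodic functions.** For $l>0$ and $f,g\in L^p_{loc}(I:Z)$ put $D^p_{S_l}[f(\cdot),g(\cdot)]:=\sup_{x\in I}\left[\frac1l\int_x^{x+l}\|f(t)-g(t)\|^p\,dt\right]^{1/p}$. Let $f\in L^p_{loc}(I:Z)$. - $f$ is equi-Weyl $p$-almost periodic, $f\in e\text{-}W_{ap}^{p}(I:Z)$, if for each $\epsilon>0$ there are $l>0$ and $L>0$ such that any interval $I'\subseteq I$ of length $L$ contains a point $\tau\in I'$ with $D^p_{S_l}[f(\cdot+\tau),f(\cdot)]\le\epsilon$. - $f$ is Weyl $p$-almost periodic, $f\in W_{ap}^{p}(I:Z)$, if for each $\epsilon>0$ there is $L>0$ such that any interval $I'\subseteq I$ of length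 $L$ contains a point $\tau\in I'$ with $\lim_{l\to\infty}D^p_{S_l}[f(\cdot+\tau),f(\cdot)]\le\epsilon$. **Two-parameter functions.** Let $f:I\times Y\to X$ be such that $f(\cdot,u)\in L^p_{loc}(I:X)$ for each fixed $u\in Y$. - $f\in e\text{-}W_{ap,\mathbf K}^{p}(I\times Y:X)$ (equi-Weyl $p$-almost periodic in $t\in I$ uniformly with respect to compact subsets of $Y$) if for each $\epsilon>0$ and each compact $K\subseteq Y$ there exist $l>0$ and $L>0$ such that any interval $I'\subseteq I$ of length $L$ contains a point $\tau\in I'$ with $$\sup_{u\in K}\sup_{x\in I}\left[\frac1l\int_x^{x+l}\|f(t+\tau,u)-f(t,u)\|^p\,dt\right]^{1/p}<\epsilon.$$ - $f\in W_{ap,\mathbf K}^{p}(I\times Y:X)$ (Weyl $p$-almost periodic in $t\in I$ uniformly with respect to compact subsets of $Y$) if for each $\epsilon>0$ and each compact $K\subseteq Y$ there is $L>0$ such that any interval $I'\subseteq I$ of length $L$ contains a point $\tau\in I'$ for which there is a finite number $l(\epsilon,\tau)>0$ such that the displayed inequality holds for all $l\ge l(\epsilon,\tau)$. *)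

theory Defs
  imports "HOL-Analysis.Analysis"
begin

text \<open>
  A complex Banach space is a real Banach space whose real scalar multiplication extends to a
  complex one with a complex-homogeneous norm. The unit law follows from \<open>scaleC_of_real\<close>.
\<close>

class complex_banach = banach +
  fixes scaleC :: "complex \<Rightarrow> 'a \<Rightarrow> 'a"
  assumes scaleC_add_right: "scaleC a (u + v) = scaleC a u + scaleC a v"
    and scaleC_add_left: "scaleC (a + b) u = scaleC a u + scaleC b u"
    and scaleC_scaleC: "scaleC a (scaleC b u) = scaleC (a * b) u"
    and scaleC_of_real: "scaleC (complex_of_real c) u = c *\<^sub>R u"
    and norm_scaleC: "norm (scaleC a u) = cmod a * norm u"

instantiation complex :: complex_banach
begin

definition scaleC_complex :: "complex \<Rightarrow> complex \<Rightarrow> complex"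
  where "scaleC_complex a u = a * u"

instance
  by standard (simp_all add: scaleC_complex_def algebra_simps norm_mult scaleR_conv_of_real)

end

text \<open>
  A function on \<open>I \<subseteq> \<real>\<close> is represented by a total function on \<^typ>\<open>real\<close>; only its values
  on \<open>I\<close> matter below. Since the target space need not be separable, measurability is Bochner's
  (strong) measurability rather than Borel measurability.
\<close>

definition strongly_measurable_on :: "real set \<Rightarrow> (real \<Rightarrow> 'z::banach) \<Rightarrow> bool"
  where "strongly_measurable_on I f \<longleftrightarrow>
    (\<exists>s. (\<forall>n::nat. simple_function (lebesgue_on I) (s n)) \<and>
         (AE t in lebesgue_on I. (\<lambda>n. s n t) \<longlonglongrightarrow> f t))"

definition Lp_loc :: "real \<Rightarrow> real set \<Rightarrow> (real \<Rightarrow> 'z::banach) set"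
  where "Lp_loc p I = {f. strongly_measurable_on I f \<and>
    (\<forall>C. compact C \<and> C \<subseteq> I \<longrightarrow> set_integrable lebesgue C (\<lambda>t. norm (f t) powr p))}"

text \<open>
  The suprema are taken in \<^typ>\<open>ennreal\<close>, so that they are infinite if unbounded. The integrals
  are finite for functions in \<^const>\<open>Lp_loc\<close>, the only ones they are applied to.
\<close>

definition stepanov :: "real \<Rightarrow> real set \<Rightarrow> (real \<Rightarrow> 'z::banach) set"
  where "stepanov p I = {f \<in> Lp_loc p I.
    (SUP t\<in>I. ennreal ((LINT s:{t..t+1}|lebesgue. norm (f s) powr p) powr (1 / p))) < \<infinity>}"

definition weyl_dist ::
    "real \<Rightarrow> real \<Rightarrow> real set \<Rightarrow> (real \<Rightarrow> 'z::banach) \<Rightarrow> (real \<Rightarrow> 'z) \<Rightarrow> ennreal"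
  where "weyl_dist p l I f g =
    (SUP x\<in>I. ennreal ((1 / l * (LINT t:{x..x+l}|lebesgue. norm (f t - g t) powr p)) powr (1 / p)))"

definition interval_of_length :: "real \<Rightarrow> real set \<Rightarrow> bool"
  where "interval_of_length L J \<longleftrightarrow>
    (\<exists>a. J \<in> {{a..a+L}, {a..<a+L}, {a<..a+L}, {a<..<a+L}})"

definition equi_weyl_ap :: "real \<Rightarrow> real set \<Rightarrow> (real \<Rightarrow> 'z::banach) set"
  where "equi_weyl_ap p I = {f \<in> Lp_loc p I.
    \<forall>\<epsilon>>0. \<exists>l>0. \<exists>L>0. \<forall>J. interval_of_length L J \<and> J \<subseteq> I \<longrightarrow>
      (\<exists>\<tau>\<in>J. weyl_dist p l I (\<lambda>t. f (t + \<tau>)) f \<le> ennreal \<epsilon>)}"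

definition weyl_ap :: "real \<Rightarrow> real set \<Rightarrow> (real \<Rightarrow> 'z::banach) set"
  where "weyl_ap p I = {f \<in> Lp_loc p I.
    \<forall>\<epsilon>>0. \<exists>L>0. \<forall>J. interval_of_length L J \<and> J \<subseteq> I \<longrightarrow>
      (\<exists>\<tau>\<in>J. \<exists>d. ((\<lambda>l. weyl_dist p l I (\<lambda>t. f (t + \<tau>)) f) \<longlongrightarrow> d) at_top \<and> d \<le> ennreal \<epsilon>)}"

definition weyl_shift_dist ::
    "real \<Rightarrow> real \<Rightarrow> real set \<Rightarrow> 'y set \<Rightarrow> real \<Rightarrow> (real \<Rightarrow> 'y \<Rightarrow> 'z::banach) \<Rightarrow> ennreal"
  where "weyl_shift_dist p l I K \<tau> f =
    (SUP u\<in>K. weyl_dist p l I (\<lambda>t. f (t + \<tau>) u) (\<lambda>t. f t u))"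

definition equi_weyl_ap_compact ::
    "real \<Rightarrow> real set \<Rightarrow> (real \<Rightarrow> 'y::banach \<Rightarrow> 'z::banach) set"
  where "equi_weyl_ap_compact p I = {f. (\<forall>u. (\<lambda>t. f t u) \<in> Lp_loc p I) \<and>
    (\<forall>\<epsilon>>0. \<forall>K. compact K \<longrightarrow>
      (\<exists>l>0. \<exists>L>0. \<forall>J. interval_of_length L J \<and> J \<subseteq> I \<longrightarrow>
        (\<exists>\<tau>\<in>J. weyl_shift_dist p l I K \<tau> f < ennreal \<epsilon>)))}"

definition weyl_ap_compact ::
    "real \<Rightarrow> real set \<Rightarrow> (real \<Rightarrow> 'y::banach \<Rightarrow> 'z::banach) set"
  where "weyl_ap_compact p I = {f. (\<forall>u. (\<lambda>t. f t u) \<in> Lp_loc p I) \<and>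
    (\<forall>\<epsilon>>0. \<forall>K. compact K \<longrightarrow>
      (\<exists>L>0. \<forall>J. interval_of_length L J \<and> J \<subseteq> I \<longrightarrow>
        (\<exists>\<tau>\<in>J. \<exists>l0>0. \<forall>l\<ge>l0. weyl_shift_dist p l I K \<tau> f < ennreal \<epsilon>)))}"

end

theory Submission
  imports Defs
begin

text \<open>
  The equation \<open>1/q = 1/p + 1/r\<close> says that a product of an \<open>r\<close>-integrable and a \<open>p\<close>-integrable
  factor is \<open>q\<close>-integrable, and a difference of \<open>F(t) = f(t, x(t))\<close> under a translation by \<open>\<tau>\<close> is
  a sum of such products. If \<open>u\<close> is a point of \<open>K\<close> within \<open>\<delta>\<close> of \<open>x(t)\<close>, then
  \<open>\<parallel>F(t+\<tau>) - F(t)\<parallel>\<close> is at most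
  \<open>\<bar>L(t+\<tau>)\<bar> \<parallel>x(t+\<tau>) - x(t)\<parallel> + \<bar>L(t+\<tau>)\<bar> \<delta> + 1 \<cdot> \<parallel>f(t+\<tau>,u) - f(t,u)\<parallel> + \<bar>L(t)\<bar> \<delta>\<close>.
  By relative compactness finitely many \<open>u\<close> serve all \<open>t\<close>, so the third term is dominated by a
  finite sum of functions with small means, although \<open>x(t)\<close> varies under the integral.

  The products are separated pointwise by \<open>(a b)\<^sup>q \<le> (\<eta> a)\<^sup>r + (b / \<eta>)\<^sup>p\<close> (lemma \<open>scaled_Young\<close>).
  After taking means over a window, the first summands are bounded by \<open>\<eta>\<^sup>r\<close> times the Stepanov bound
  of \<open>L\<close>, and the second ones are small by the choice of \<open>\<delta>\<close> and of \<open>\<tau>\<close>. This gives the estimate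
  \<open>superposition_shift_estimate\<close>, which is common to both versions of the theorem.

  Two further points need care. The Stepanov bound controls means only over windows that are not
  too short, and in the Weyl version the distance has to possess a limit as the windows grow. Both
  follow from comparing the distances for two window lengths (\<open>weyl_dist_window_change\<close>): short
  windows may be enlarged to length \<open>1\<close> at the cost of a constant factor, and the distance converges
  to its infimum over all window lengths (\<open>weyl_dist_tendsto\<close>). Finally, \<open>F\<close> is strongly measurable
  although \<open>Y\<close> and \<open>X\<close> may be nonseparable, because the simple approximations of \<open>x\<close> involve only
  countably many sections of \<open>f\<close> (\<open>strongly_measurable_on_superposition\<close>).
\<close>

section \<open>Strong measurability\<close>

text \<open>Pettis' description of strong measurability. It is preferable to the definition when limits are
  taken: a pointwise limit of Borel maps is Borel and a countable union of countable sets is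
  countable, whereas a limit of limits of simple functions would need a diagonal argument.\<close>

lemma strongly_measurable_on_iff_borel_separable:
  fixes f :: "real \<Rightarrow> 'z::banach"
  shows "strongly_measurable_on I f \<longleftrightarrow>
    (\<exists>g D. g \<in> borel_measurable (lebesgue_on I) \<and> countable D \<and> (\<forall>t\<in>I. g t \<in> closure D) \<and>
      (AE t in lebesgue_on I. g t = f t))"
proof
  assume "strongly_measurable_on I f"
  then obtain s where s: "\<And>n::nat. simple_function (lebesgue_on I) (s n)"
    and lim: "AE t in lebesgue_on I. (\<lambda>n. s n t) \<longlonglongrightarrow> f t"
    unfolding strongly_measurable_on_def by blast
  from lim obtain N where N: "N \<in> null_sets (lebesgue_on I)"
    and "{t \<in> space (lebesgue_on I). \<not> (\<lambda>n. s n t) \<longlonglongrightarrow> f t} \<subseteq> N"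
    by (auto simp: eventually_ae_filter)
  then have conv: "\<And>t. t \<in> I \<Longrightarrow> t \<notin> N \<Longrightarrow> (\<lambda>n. s n t) \<longlonglongrightarrow> f t"
    by auto
  define g where "g t = (if t \<in> N then 0 else f t)" for t
  define D where "D = insert 0 (\<Union>n. s n ` I)"
  have [measurable]: "N \<in> sets (lebesgue_on I)" using N by auto
  have [measurable]: "s n \<in> borel_measurable (lebesgue_on I)" for n
    using s by (rule borel_measurable_simple_function)
  have "g \<in> borel_measurable (lebesgue_on I)"
  proof (rule borel_measurable_LIMSEQ_metric)
    show "(\<lambda>t. if t \<in> N then 0 else s n t) \<in> borel_measurable (lebesgue_on I)" for n
      by measurable
    show "(\<lambda>n. if t \<in> N then 0 else s n t) \<longlonglongrightarrow> g t" if "t \<in> space (lebesgue_on I)" for t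
      using conv that by (auto simp: g_def)
  qed
  moreover have "countable D"
    unfolding D_def using simple_functionD(1)[OF s]
    by (intro countable_insert countable_UN) (auto intro: countable_finite)
  moreover have "g t \<in> closure D" if "t \<in> I" for t
  proof (cases "t \<in> N")
    case True
    then show ?thesis using closure_subset[of D] by (auto simp: g_def D_def)
  next
    case False
    with conv that have "(\<lambda>n. s n t) \<longlonglongrightarrow> g t" by (auto simp: g_def)
    moreover have "\<forall>n. s n t \<in> D" using that by (auto simp: D_def)
    ultimately show ?thesis by (auto simp: closure_sequential)
  qed
  moreover have "AE t in lebesgue_on I. g t = f t"
    using N by (rule AE_I') (auto simp: g_def)
  ultimately show "\<exists>g D. g \<in> borel_measurable (lebesgue_on I) \<and> countable D \<and>
      (\<forall>t\<in>I. g t \<in> closure D) \<and> (AE t in lebesgue_on I. g t = f t)"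
    by blast
next
  assume "\<exists>g D. g \<in> borel_measurable (lebesgue_on I) \<and> countable D \<and> (\<forall>t\<in>I. g t \<in> closure D) \<and>
      (AE t in lebesgue_on I. g t = f t)"
  then obtain g D where [measurable]: "g \<in> borel_measurable (lebesgue_on I)" and D: "countable D"
    and cl: "\<And>t. t \<in> I \<Longrightarrow> g t \<in> closure D" and ae: "AE t in lebesgue_on I. g t = f t"
    by blast
  define d where "d = from_nat_into (insert 0 D)"
  have d: "range d = insert 0 D" unfolding d_def using D by (intro range_from_nat_into) auto
  \<comment> \<open>The value of \<open>s n\<close> is a closest point to \<open>g\<close> among the first \<open>n + 1\<close> points of the
    dense sequence; comparing one new point at a time keeps \<open>s n\<close> simple.\<close>
  define s where "s = rec_nat (\<lambda>t. d 0)
    (\<lambda>n u t. if dist (g t) (d (Suc n)) < dist (g t) (u t) then d (Suc n) else u t)"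
  have s0: "s 0 = (\<lambda>t. d 0)" and sS: "s (Suc n) =
      (\<lambda>t. if dist (g t) (d (Suc n)) < dist (g t) (s n t) then d (Suc n) else s n t)" for n
    unfolding s_def by simp_all
  have ran: "s n t \<in> range d" for n t by (induction n) (auto simp: s0 sS)
  have simp: "simple_function (lebesgue_on I) (s n)" for n
  proof (induction n)
    case 0
    show ?case by (simp add: s0)
  next
    case (Suc n)
    have [measurable]: "(\<lambda>t. dist (g t) v) \<in> borel_measurable (lebesgue_on I)" for v
      by (rule borel_measurable_continuous_on[where f="\<lambda>u. dist u v"])
        (auto intro: continuous_intros)
    have "s n \<in> measurable (lebesgue_on I) (count_space (s n ` I))"
      using measurable_simple_function[OF Suc] by (auto simp: measurable_def)
    then have [measurable]: "(\<lambda>t. dist (g t) (s n t)) \<in> borel_measurable (lebesgue_on I)"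
      using simple_functionD(1)[OF Suc]
      by (intro measurable_compose_countable'[where f="\<lambda>v t. dist (g t) v" and g="s n"])
        (auto intro: countable_finite)
    have "{t \<in> space (lebesgue_on I). dist (g t) (d (Suc n)) < dist (g t) (s n t)}
        \<in> sets (lebesgue_on I)" by measurable
    then show ?case unfolding sS using Suc by (intro simple_function_If) auto
  qed
  have best: "dist (g t) (s n t) \<le> dist (g t) (d k)" if "k \<le> n" for n k t
    using that
  proof (induction n)
    case 0
    then show ?case by (simp add: s0)
  next
    case (Suc n)
    then show ?case by (cases "k = Suc n") (auto simp: sS)
  qed
  have "(\<lambda>n. s n t) \<longlonglongrightarrow> g t" if t: "t \<in> I" for t
  proof (rule metric_LIMSEQ_I)
    fix e :: real assume "0 < e"
    then obtain v where "v \<in> D" "dist v (g t) < e"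
      using cl[OF t] by (auto simp: closure_approachable)
    then obtain k where "dist (g t) (d k) < e" using d by (metis dist_commute insertCI rangeE)
    then show "\<exists>no. \<forall>n\<ge>no. dist (s n t) (g t) < e"
      using best by (metis dist_commute le_less_trans)
  qed
  then have "AE t in lebesgue_on I. g t = f t \<longrightarrow> (\<lambda>n. s n t) \<longlonglongrightarrow> f t"
    by (intro AE_I2) (metis space_lebesgue_on)
  with ae have "AE t in lebesgue_on I. (\<lambda>n. s n t) \<longlonglongrightarrow> f t"
    by (rule AE_mp)
  with simp show "strongly_measurable_on I f" unfolding strongly_measurable_on_def by blast
qed

text \<open>The simple approximations of \<open>x\<close> take values in a countable set \<open>U\<close>, so along them the
  superposition is glued from the sections \<open>f(\<cdot>, u)\<close> with \<open>u \<in> U\<close>. Replacing each of these countably many sections by a Borel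
  representative costs one null set, and continuity of \<open>f t\<close> passes from the simple
  approximations of \<open>x\<close> to \<open>x\<close> itself.\<close>

lemma strongly_measurable_on_superposition:
  fixes f :: "real \<Rightarrow> 'y::banach \<Rightarrow> 'z::banach"
  assumes f: "\<And>u. strongly_measurable_on I (\<lambda>t. f t u)"
    and cont: "\<And>t. t \<in> I \<Longrightarrow> continuous_on UNIV (f t)"
    and x: "strongly_measurable_on I x"
  shows "strongly_measurable_on I (\<lambda>t. f t (x t))"
proof -
  from x obtain s where s: "\<And>n::nat. simple_function (lebesgue_on I) (s n)"
    and lim: "AE t in lebesgue_on I. (\<lambda>n. s n t) \<longlonglongrightarrow> x t"
    unfolding strongly_measurable_on_def by blast
  define U where "U = (\<Union>n. s n ` I)"
  have U: "countable U"
    unfolding U_def using simple_functionD(1)[OF s]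
    by (intro countable_UN) (auto intro: countable_finite)
  have "\<forall>u. \<exists>g D. g \<in> borel_measurable (lebesgue_on I) \<and> countable D \<and> (\<forall>t\<in>I. g t \<in> closure D) \<and>
      (AE t in lebesgue_on I. g t = f t u)"
    using f by (simp add: strongly_measurable_on_iff_borel_separable)
  then obtain g D where g: "\<And>u. g u \<in> borel_measurable (lebesgue_on I)"
    and D: "\<And>u. countable (D u)" "\<And>u t. t \<in> I \<Longrightarrow> g u t \<in> closure (D u)"
    and gf: "\<And>u. AE t in lebesgue_on I. g u t = f t u"
    by metis
  have "AE t in lebesgue_on I. (\<forall>u\<in>U. g u t = f t u) \<and> (\<lambda>n. s n t) \<longlonglongrightarrow> x t"
    using gf lim U by (simp add: AE_ball_countable)
  then obtain N where N: "N \<in> null_sets (lebesgue_on I)"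
    and "{t \<in> space (lebesgue_on I). \<not> ((\<forall>u\<in>U. g u t = f t u) \<and> (\<lambda>n. s n t) \<longlonglongrightarrow> x t)} \<subseteq> N"
    by (auto simp: eventually_ae_filter)
  then have off: "\<And>t u. t \<in> I \<Longrightarrow> t \<notin> N \<Longrightarrow> u \<in> U \<Longrightarrow> g u t = f t u"
    "\<And>t. t \<in> I \<Longrightarrow> t \<notin> N \<Longrightarrow> (\<lambda>n. s n t) \<longlonglongrightarrow> x t" by auto
  have sU: "s n t \<in> U" if "t \<in> I" for n t using that by (auto simp: U_def)
  define h where "h t = (if t \<in> N then 0 else f t (x t))" for t
  define C where "C = insert 0 (\<Union>u\<in>U. D u)"
  have conv: "(\<lambda>n. if t \<in> N then 0 else g (s n t) t) \<longlonglongrightarrow> h t" if "t \<in> I" for t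
  proof (cases "t \<in> N")
    case False
    have "(\<lambda>n. f t (s n t)) \<longlonglongrightarrow> f t (x t)"
      using continuous_on_tendsto_compose[OF cont[OF that] off(2)[OF that False]] by simp
    with False off(1)[OF that False] sU[OF that] show ?thesis by (simp add: h_def)
  qed (simp add: h_def)
  have [measurable]: "N \<in> sets (lebesgue_on I)" using N by auto
  have [measurable]: "(\<lambda>t. g (s n t) t) \<in> borel_measurable (lebesgue_on I)" for n
  proof (rule measurable_compose_countable'[where f=g and g="s n"])
    show "s n \<in> measurable (lebesgue_on I) (count_space U)"
      using measurable_simple_function[OF s[of n]] sU by (auto simp: measurable_def)
  qed (use g U in auto)
  have "h \<in> borel_measurable (lebesgue_on I)"
    by (rule borel_measurable_LIMSEQ_metric[where f="\<lambda>n t. if t \<in> N then 0 else g (s n t) t"])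
      (use conv in auto)
  moreover have "countable C" using U D(1) by (auto simp: C_def)
  moreover have "h t \<in> closure C" if "t \<in> I" for t
  proof (rule Lim_in_closed_set[OF closed_closure _ _ conv[OF that]])
    show "\<forall>\<^sub>F n in sequentially. (if t \<in> N then 0 else g (s n t) t) \<in> closure C"
    proof (intro always_eventually allI)
      fix n
      have "closure (D (s n t)) \<subseteq> closure C"
        using sU[OF that] by (intro closure_mono) (auto simp: C_def)
      then show "(if t \<in> N then 0 else g (s n t) t) \<in> closure C"
        using D(2)[OF that] closure_subset[of C] by (auto simp: C_def)
    qed
  qed auto
  moreover have "AE t in lebesgue_on I. h t = f t (x t)"
    using N by (rule AE_I') (auto simp: h_def)
  ultimately show ?thesis
    unfolding strongly_measurable_on_iff_borel_separable by blast
qed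

lemma strongly_measurable_on_diff:
  assumes "strongly_measurable_on I f" "strongly_measurable_on I g"
  shows "strongly_measurable_on I (\<lambda>t. f t - g t)"
proof -
  from assms obtain s s' where *: "\<And>n::nat. simple_function (lebesgue_on I) (s n)"
      "AE t in lebesgue_on I. (\<lambda>n. s n t) \<longlonglongrightarrow> f t"
      "\<And>n::nat. simple_function (lebesgue_on I) (s' n)"
      "AE t in lebesgue_on I. (\<lambda>n. s' n t) \<longlonglongrightarrow> g t"
    unfolding strongly_measurable_on_def by blast
  have "AE t in lebesgue_on I. (\<lambda>n. s n t - s' n t) \<longlonglongrightarrow> f t - g t"
    using *(2,4) by eventually_elim (rule tendsto_diff)
  with *(1,3) show ?thesis
    unfolding strongly_measurable_on_def by (intro exI[of _ "\<lambda>n t. s n t - s' n t"]) auto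
qed

text \<open>Besides measurability of the translation, the null set where the approximation fails has to be
  translated, and Lebesgue null sets are translation invariant.\<close>

lemma strongly_measurable_on_shift:
  assumes "I \<in> sets lebesgue" "\<And>t. t \<in> I \<Longrightarrow> t + \<tau> \<in> I" and f: "strongly_measurable_on I f"
  shows "strongly_measurable_on I (\<lambda>t. f (t + \<tau>))"
proof -
  from f obtain s where s: "\<And>n::nat. simple_function (lebesgue_on I) (s n)"
    and lim: "AE t in lebesgue_on I. (\<lambda>n. s n t) \<longlonglongrightarrow> f t"
    unfolding strongly_measurable_on_def by blast
  have "(\<lambda>t. \<tau> + 1 * t) \<in> lebesgue \<rightarrow>\<^sub>M lebesgue"
    using lebesgue_affine_measurable[where c= "\<lambda>x::real. 1" and t=\<tau>] by simp
  then have shift: "(\<lambda>t. t + \<tau>) \<in> lebesgue_on I \<rightarrow>\<^sub>M lebesgue_on I"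
    using assms(2)
    by (intro measurable_restrict_space2 measurable_restrict_space1) (auto simp: add.commute)
  have simp: "simple_function (lebesgue_on I) (\<lambda>t. s n (t + \<tau>))" for n
    unfolding simple_function_eq_measurable
  proof
    have "(\<lambda>t. s n (t + \<tau>)) ` space (lebesgue_on I) \<subseteq> s n ` space (lebesgue_on I)"
      using assms(2) by auto
    then show "finite ((\<lambda>t. s n (t + \<tau>)) ` space (lebesgue_on I))"
      using simple_functionD(1)[OF s] by (rule finite_subset)
    show "(\<lambda>t. s n (t + \<tau>)) \<in> lebesgue_on I \<rightarrow>\<^sub>M count_space UNIV"
      using measurable_compose[OF shift measurable_simple_function[OF s]] .
  qed
  from lim obtain N where "N \<in> null_sets (lebesgue_on I)"
    and "{t \<in> space (lebesgue_on I). \<not> (\<lambda>n. s n t) \<longlonglongrightarrow> f t} \<subseteq> N"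
    by (auto simp: eventually_ae_filter)
  then have N: "N \<in> null_sets lebesgue" and conv: "\<And>t. t \<in> I \<Longrightarrow> t \<notin> N \<Longrightarrow> (\<lambda>n. s n t) \<longlonglongrightarrow> f t"
    using assms(1) by (auto simp: null_sets_restrict_space)
  have "(+) (-\<tau>) ` N \<in> null_sets lebesgue"
    using N negligible_translation[of N "-\<tau>"] by (simp add: negligible_iff_null_sets)
  then have "AE t in lebesgue. t \<in> I \<longrightarrow> (\<lambda>n. s n (t + \<tau>)) \<longlonglongrightarrow> f (t + \<tau>)"
  proof (rule AE_I')
    show "{t \<in> space lebesgue. \<not> (t \<in> I \<longrightarrow> (\<lambda>n. s n (t + \<tau>)) \<longlonglongrightarrow> f (t + \<tau>))} \<subseteq> (+) (-\<tau>) ` N"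
      using conv assms(2) by (force simp: image_iff intro: bexI[of _ "_ + \<tau>"])
  qed
  then have "AE t in lebesgue_on I. (\<lambda>n. s n (t + \<tau>)) \<longlonglongrightarrow> f (t + \<tau>)"
    using assms(1) by (simp add: AE_restrict_space_iff)
  with simp show ?thesis
    unfolding strongly_measurable_on_def by (intro exI[of _ "\<lambda>n t. s n (t + \<tau>)"]) auto
qed

text \<open>The Borel representative differs from \<open>f\<close> on a null set only. The passage back to \<open>f\<close>, by
  completeness of Lebesgue measure, is made after taking norms, for a real function.\<close>

lemma strongly_measurable_on_norm:
  assumes "I \<in> sets lebesgue" and f: "strongly_measurable_on I f"
  shows "(\<lambda>t. norm (f t)) \<in> borel_measurable (lebesgue_on I)"
proof -
  from f obtain g D where g: "g \<in> borel_measurable (lebesgue_on I)" 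
    and "AE t in lebesgue_on I. g t = f t"
    unfolding strongly_measurable_on_iff_borel_separable by blast
  then obtain N where N: "N \<in> null_sets (lebesgue_on I)"
    and "{t \<in> space (lebesgue_on I). g t \<noteq> f t} \<subseteq> N"
    by (auto simp: eventually_ae_filter)
  then have eq: "\<And>t. t \<in> I - N \<Longrightarrow> g t = f t" by auto
  have "(\<lambda>t. norm (g t)) \<in> borel_measurable (lebesgue_on I)"
    by (rule borel_measurable_continuous_on[OF _ g]) (auto intro: continuous_intros)
  then have "(\<lambda>t. norm (g t)) \<in> borel_measurable (lebesgue_on (I - N))"
    by (simp add: borel_measurable_diff_null[OF N assms(1)])
  then have "(\<lambda>t. norm (f t)) \<in> borel_measurable (lebesgue_on (I - N))"
    by (rule measurable_cong[THEN iffD1, rotated]) (use eq in auto)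
  then show ?thesis by (simp add: borel_measurable_diff_null[OF N assms(1)])
qed

section \<open>Means over windows and the Weyl distance\<close>

lemma weyl_dist_le_iff:
  assumes "0 < p" "0 < l" "0 \<le> e"
  shows "weyl_dist p l I f g \<le> ennreal e \<longleftrightarrow>
    (\<forall>x\<in>I. (LINT t:{x..x+l}|lebesgue. norm (f t - g t) powr p) \<le> l * e powr p)"
proof -
  have nonneg: "0 \<le> (LINT t:{x..x+l}|lebesgue. norm (f t - g t) powr p)" for x
    by (simp add: set_lebesgue_integral_def)
  have "(1 / l * J) powr (1 / p) \<le> e \<longleftrightarrow> J \<le> l * e powr p" if "0 \<le> J" for J :: real
  proof
    assume "(1 / l * J) powr (1 / p) \<le> e"
    then have "((1 / l * J) powr (1 / p)) powr p \<le> e powr p"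
      using assms by (intro powr_mono2) auto
    then show "J \<le> l * e powr p"
      using assms that by (simp add: powr_powr field_simps)
  next
    assume "J \<le> l * e powr p"
    then have "(1 / l * J) powr (1 / p) \<le> (e powr p) powr (1 / p)"
      using assms that by (intro powr_mono2) (auto simp: field_simps)
    then show "(1 / l * J) powr (1 / p) \<le> e"
      using assms by (simp add: powr_powr)
  qed
  with nonneg show ?thesis
    using assms by (simp add: weyl_dist_def SUP_le_iff ennreal_le_iff)
qed

text \<open>
  Local integrability on the line or a half-line, phrased for the windows over which the Weyl and
  Stepanov distances take means.
\<close>

definition window_integrable :: "real set \<Rightarrow> (real \<Rightarrow> real) \<Rightarrow> bool"
  where "window_integrable I g \<longleftrightarrow> (\<forall>t\<in>I. \<forall>l. set_integrable lebesgue {t..t+l} g)"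

lemma set_integral_shift:
  fixes g :: "real \<Rightarrow> real"
  shows "(LINT s:{t..t+l}|lebesgue. g (s + \<tau>)) = (LINT s:{t+\<tau>..t+\<tau>+l}|lebesgue. g s)"
    and "set_integrable lebesgue {t..t+l} (\<lambda>s. g (s + \<tau>)) \<longleftrightarrow>
      set_integrable lebesgue {t+\<tau>..t+\<tau>+l} g"
proof -
  have eq: "(\<lambda>s. indicator {t..t+l} s *\<^sub>R g (s + \<tau>)) =
      (\<lambda>s. indicator {t+\<tau>..t+\<tau>+l} (\<tau> + 1 * s) *\<^sub>R g (\<tau> + 1 * s))"
    by (auto simp: fun_eq_iff indicator_def add.commute)
  show "(LINT s:{t..t+l}|lebesgue. g (s + \<tau>)) = (LINT s:{t+\<tau>..t+\<tau>+l}|lebesgue. g s)"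
    unfolding set_lebesgue_integral_def eq
    using lebesgue_integral_real_affine[of 1 "\<lambda>s. indicator {t+\<tau>..t+\<tau>+l} s *\<^sub>R g s" \<tau>] by simp
  show "set_integrable lebesgue {t..t+l} (\<lambda>s. g (s + \<tau>)) \<longleftrightarrow>
      set_integrable lebesgue {t+\<tau>..t+\<tau>+l} g"
    unfolding set_integrable_def eq
    using lebesgue_integrable_real_affine_iff[of 1 "\<lambda>s. indicator {t+\<tau>..t+\<tau>+l} s *\<^sub>R g s" \<tau>]
    by simp
qed

lemma line_or_half_line:
  assumes "I = UNIV \<or> I = {0::real..}"
  shows "t \<in> I \<Longrightarrow> t \<le> s \<Longrightarrow> s \<in> I" and "t \<in> I \<Longrightarrow> \<tau> \<in> I \<Longrightarrow> t + \<tau> \<in> I"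
    and "I \<in> sets lebesgue" and "I \<noteq> {}"
  using assms by auto

lemma window_integrable_add:
  "window_integrable I g \<Longrightarrow> window_integrable I h \<Longrightarrow> window_integrable I (\<lambda>t. g t + h t)"
  by (auto simp: window_integrable_def)

lemma window_integrable_cmult: "window_integrable I g \<Longrightarrow> window_integrable I (\<lambda>t. c * g t)"
  by (auto simp: window_integrable_def)

lemma window_integrable_const: "window_integrable I (\<lambda>t. c)"
  by (auto simp: window_integrable_def absolutely_integrable_on_const)

lemma window_integrable_sum:
  assumes "\<And>i. i \<in> A \<Longrightarrow> window_integrable I (G i)"
  shows "window_integrable I (\<lambda>t. \<Sum>i\<in>A. G i t)"
  using assms unfolding window_integrable_def set_integrable_def scaleR_sum_right
  by (intro ballI allI Bochner_Integration.integrable_sum) auto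

lemmas window_integrable_intros =
  window_integrable_add window_integrable_cmult window_integrable_const window_integrable_sum

text \<open>A window of length \<open>l\<close> is covered by \<open>\<lceil>l / h\<rceil> \<le> l / h + 1\<close> consecutive windows of length \<open>h\<close>.\<close>

lemma window_integral_le:
  assumes "I = UNIV \<or> I = {0..}" and g: "window_integrable I g" and pos: "\<And>t. 0 \<le> g t"
    and "0 < h" "0 < l" "t \<in> I"
    and B: "\<And>y. y \<in> I \<Longrightarrow> (LINT s:{y..y+h}|lebesgue. g s) \<le> B"
  shows "(LINT s:{t..t+l}|lebesgue. g s) \<le> (l / h + 1) * B"
proof -
  have step: "(LINT s:{t..t+real n*h}|lebesgue. g s) \<le> real n * B" for n
  proof (induction n)
    case 0
    have "(LINT s:{t..t+0}|lebesgue. g s) = (LINT s:{t}|lebesgue. g s)" by simp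
    also have "\<dots> = 0"
      unfolding set_lebesgue_integral_def
      by (rule integral_eq_zero_AE) (rule AE_I'[of "{t}"], auto simp: indicator_def split: if_splits)
    finally show ?case by simp
  next
    case (Suc n)
    let ?y = "t + real n * h"
    have y: "?y \<in> I" using line_or_half_line(1)[OF assms(1) \<open>t \<in> I\<close>, of ?y] \<open>0 < h\<close> by simp
    have int: "set_integrable lebesgue {t..?y} g" "set_integrable lebesgue {?y..?y+h} g"
      using g y \<open>t \<in> I\<close> by (auto simp: window_integrable_def)
    have "(LINT s:{t..t+real (Suc n)*h}|lebesgue. g s) \<le>
        (LINT s|lebesgue. indicator {t..?y} s *\<^sub>R g s + indicator {?y..?y+h} s *\<^sub>R g s)"
      unfolding set_lebesgue_integral_def
      using int pos unfolding set_integrable_def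
      by (intro integral_mono') (auto simp: indicator_def algebra_simps)
    also have "\<dots> = (LINT s:{t..?y}|lebesgue. g s) + (LINT s:{?y..?y+h}|lebesgue. g s)"
      using int unfolding set_lebesgue_integral_def set_integrable_def
      by (rule Bochner_Integration.integral_add)
    also have "\<dots> \<le> real n * B + B" using Suc B[OF y] by simp
    finally show ?case by (simp add: algebra_simps)
  qed
  define n where "n = nat \<lceil>l / h\<rceil>"
  have n: "l / h \<le> real n" "real n \<le> l / h + 1"
    unfolding n_def using assms by (simp_all add: real_nat_ceiling_ge)
  have "0 \<le> (LINT s:{t..t+h}|lebesgue. g s)" by (simp add: set_lebesgue_integral_def pos)
  then have "0 \<le> B" using B[OF \<open>t \<in> I\<close>] by linarith
  have "(LINT s:{t..t+l}|lebesgue. g s) \<le> (LINT s:{t..t+real n*h}|lebesgue. g s)"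
    unfolding set_lebesgue_integral_def
    using g \<open>t \<in> I\<close> pos n(1) \<open>0 < h\<close> unfolding window_integrable_def set_integrable_def
    by (intro integral_mono') (auto simp: indicator_def field_simps)
  also have "\<dots> \<le> real n * B" by (rule step)
  also have "\<dots> \<le> (l / h + 1) * B" using n(2) \<open>0 \<le> B\<close> by (rule mult_right_mono)
  finally show ?thesis .
qed

text \<open>The factor tends to \<open>1\<close> as \<open>l\<close> grows, which makes the distances converge, and it is at most \<open>2\<close>
  for \<open>l \<ge> h\<close> and \<open>p \<ge> 1\<close>, which allows short windows to be replaced by windows of length at
  least \<open>1\<close>.\<close>

lemma weyl_dist_window_change:
  assumes "I = UNIV \<or> I = {0..}" "0 < p" "0 < h" "0 < l"
    and int: "window_integrable I (\<lambda>t. norm (f t - g t) powr p)"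
  shows "weyl_dist p l I f g \<le> ennreal ((1 + h / l) powr (1 / p)) * weyl_dist p h I f g"
proof (cases "weyl_dist p h I f g")
  case (real e)
  then have "\<forall>x\<in>I. (LINT t:{x..x+h}|lebesgue. norm (f t - g t) powr p) \<le> h * e powr p"
    using weyl_dist_le_iff[of p h e I f g] assms by auto
  then have "(LINT t:{x..x+l}|lebesgue. norm (f t - g t) powr p) \<le> (l / h + 1) * (h * e powr p)"
    if "x \<in> I" for x
    using assms that by (intro window_integral_le[OF assms(1) int]) auto
  moreover have "(l / h + 1) * (h * e powr p) = l * ((1 + h / l) powr (1 / p) * e) powr p"
    using assms real by (simp add: powr_mult powr_powr field_simps)
  ultimately have "weyl_dist p l I f g \<le> ennreal ((1 + h / l) powr (1 / p) * e)"
    using assms real by (subst weyl_dist_le_iff) auto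
  also have "\<dots> = ennreal ((1 + h / l) powr (1 / p)) * weyl_dist p h I f g"
    using real by (simp add: ennreal_mult)
  finally show ?thesis .
next
  case top
  have "0 < (1 + h / l) powr (1 / p)"
    using assms by (simp add: add_pos_pos)
       (smt (verit) divide_pos_pos)
  then show ?thesis using top by (simp add: ennreal_mult_top)
qed

text \<open>An instance of Fekete's subadditivity argument: the supremum over \<open>x\<close> of the integral over
  \<open>{x..x+l}\<close> is subadditive in \<open>l\<close>, so its quotient by \<open>l\<close> converges to the infimum.
  In particular one window length with a small distance already makes the limit small.\<close>

lemma weyl_dist_tendsto:
  assumes I: "I = UNIV \<or> I = {0..}" and "0 < p"
    and int: "window_integrable I (\<lambda>t. norm (f t - g t) powr p)"
  shows "((\<lambda>l. weyl_dist p l I f g) \<longlongrightarrow> (INF h\<in>{0<..}. weyl_dist p h I f g)) at_top"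
proof (rule order_tendstoI)
  fix a assume "a < (INF h\<in>{0<..}. weyl_dist p h I f g)"
  moreover have "\<forall>\<^sub>F l in at_top. (INF h\<in>{0<..}. weyl_dist p h I f g) \<le> weyl_dist p l I f g"
    using eventually_gt_at_top[of "0::real"] by eventually_elim (auto intro: INF_lower)
  ultimately show "\<forall>\<^sub>F l in at_top. a < weyl_dist p l I f g"
    by (auto elim: eventually_mono)
next
  fix a assume "(INF h\<in>{0<..}. weyl_dist p h I f g) < a"
  then obtain h where h: "0 < h" "weyl_dist p h I f g < a" by (auto simp: INF_less_iff)
  have "((\<lambda>l. (1 + h / l) powr (1 / p)) \<longlongrightarrow> (1 + 0) powr (1 / p)) at_top"
    by (intro tendsto_intros tendsto_divide_0[OF tendsto_const] filterlim_at_top_imp_at_infinity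
        filterlim_ident) auto
  then have "((\<lambda>l. ennreal ((1 + h / l) powr (1 / p)) * weyl_dist p h I f g)
      \<longlongrightarrow> ennreal 1 * weyl_dist p h I f g) at_top"
    using h(2) by (intro tendsto_mult_ennreal tendsto_const tendsto_ennrealI) auto
  then have "\<forall>\<^sub>F l in at_top. ennreal ((1 + h / l) powr (1 / p)) * weyl_dist p h I f g < a"
    using h(2) by (intro order_tendstoD(2)) auto
  with eventually_gt_at_top[of "0::real"] show "\<forall>\<^sub>F l in at_top. weyl_dist p l I f g < a"
    by eventually_elim
      (use weyl_dist_window_change[OF I \<open>0 < p\<close> \<open>0 < h\<close> _ int] in \<open>auto intro: le_less_trans\<close>)
qed

section \<open>Elementary inequalities\<close>

text \<open>Young's inequality with the exponents \<open>(p + r) / p\<close> and \<open>(p + r) / r\<close>, applied to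
  \<open>(\<eta> a)\<^sup>r\<close> and \<open>(b / \<eta>)\<^sup>p\<close>. The parameter \<open>\<eta>\<close> makes it a pointwise substitute for Hoelder's
  inequality: a bounded mean of \<open>a\<^sup>r\<close> gets a small weight, a small mean of \<open>b\<^sup>p\<close> a large one.\<close>

lemma scaled_Young:
  fixes a b \<eta> :: real
  assumes "0 < p" "0 < r" "q = p * r / (p + r)" "0 < \<eta>" "0 \<le> a" "0 \<le> b"
  shows "(a * b) powr q \<le> \<eta> powr r * a powr r + \<eta> powr (-p) * b powr p"
proof (cases "a = 0 \<or> b = 0")
  case False
  define A where "A = (\<eta> * a) powr r"
  define B where "B = (b / \<eta>) powr p"
  have pos: "0 < A" "0 < B" using False assms by (auto simp: A_def B_def)
  have "A powr (p / (p + r)) * B powr (r / (p + r)) \<le> p / (p + r) * A + r / (p + r) * B"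
    using assms pos by (intro Youngs_inequality_0) (auto simp: add_divide_distrib[symmetric])
  also have "\<dots> \<le> 1 * A + 1 * B"
    using assms pos by (intro add_mono mult_right_mono) (auto simp: field_simps)
  also have "A powr (p / (p + r)) * B powr (r / (p + r)) = (\<eta> * a) powr q * (b / \<eta>) powr q"
    using assms by (simp add: A_def B_def powr_powr mult.commute)
  also have "\<dots> = (a * b) powr q"
    using assms by (simp add: powr_mult[symmetric])
  finally have "(a * b) powr q \<le> A + B" by simp
  also have "A + B = \<eta> powr r * a powr r + \<eta> powr (-p) * b powr p"
    using assms by (simp add: A_def B_def powr_mult powr_divide powr_minus_divide)
  finally show ?thesis .
qed auto

lemma powr_add4_le:
  fixes a b c d :: real
  assumes "0 \<le> a" "0 \<le> b" "0 \<le> c" "0 \<le> d" "0 < q"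
  shows "(a + b + c + d) powr q \<le> 4 powr q * (a powr q + b powr q + c powr q + d powr q)"
proof -
  define m where "m = max (max a b) (max c d)"
  have "m = a \<or> m = b \<or> m = c \<or> m = d" by (auto simp: m_def max_def)
  then have m: "m powr q \<le> a powr q + b powr q + c powr q + d powr q" by auto
  have "(a + b + c + d) powr q \<le> (4 * m) powr q"
    using assms by (intro powr_mono2) (auto simp: m_def)
  also have "\<dots> = 4 powr q * m powr q" using assms by (simp add: m_def powr_mult)
  also have "\<dots> \<le> 4 powr q * (a powr q + b powr q + c powr q + d powr q)"
    using m by (intro mult_left_mono) auto
  finally show ?thesis .
qed

text \<open>The choice of each of the small parameters \<open>\<eta>\<close>, \<open>\<delta>\<close> and \<open>\<epsilon>'\<close> of the main estimate.\<close>

lemma small_powr_exists: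
  fixes A B r :: real
  assumes "0 \<le> A" "0 < B" "0 < r"
  obtains \<eta> where "0 < \<eta>" "A * \<eta> powr r \<le> B"
proof
  show "0 < (B / (A + 1)) powr (1 / r)" using assms by auto
  show "A * ((B / (A + 1)) powr (1 / r)) powr r \<le> B"
    using assms by (simp add: powr_powr field_simps)
qed

section \<open>Locally integrable functions\<close>

lemma Lp_loc_window_integrable:
  assumes "I = UNIV \<or> I = {0..}" "f \<in> Lp_loc p I"
  shows "window_integrable I (\<lambda>t. norm (f t) powr p)"
  unfolding window_integrable_def
proof (intro ballI allI)
  fix t l assume "t \<in> I"
  then have "{t..t+l} \<subseteq> I" using line_or_half_line(1)[OF assms(1)] by auto
  then show "set_integrable lebesgue {t..t+l} (\<lambda>t. norm (f t) powr p)"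
    using assms(2) by (simp add: Lp_loc_def)
qed

lemma Lp_locI:
  assumes I: "I = UNIV \<or> I = {0..}" and "strongly_measurable_on I f"
    and int: "window_integrable I (\<lambda>t. norm (f t) powr p)"
  shows "f \<in> Lp_loc p I"
  unfolding Lp_loc_def
proof (intro CollectI conjI allI impI)
  fix C assume C: "compact C \<and> C \<subseteq> I"
  show "set_integrable lebesgue C (\<lambda>t. norm (f t) powr p)"
  proof (cases "C = {}")
    case False
    then have "Inf C \<in> C" "bdd_above C" "bdd_below C"
      using C by (auto intro!: closed_contains_Inf
          simp: compact_imp_closed compact_imp_bounded bounded_imp_bdd_above bounded_imp_bdd_below)
    moreover from this have "C \<subseteq> {Inf C..Inf C + (Sup C - Inf C)}"
      by (auto intro: cInf_lower cSup_upper)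
    moreover have "C \<in> sets lebesgue" using C by (auto intro: lmeasurable_compact fmeasurableD)
    ultimately show ?thesis
      using int C unfolding window_integrable_def by (blast intro: set_integrable_subset)
  qed (simp add: set_integrable_def)
qed fact

lemma window_integrable_bound:
  assumes I: "I = UNIV \<or> I = {0..}" and meas: "strongly_measurable_on I f"
    and h: "window_integrable I h"
    and le: "\<And>t. t \<in> I \<Longrightarrow> norm (f t) powr p \<le> h t"
  shows "window_integrable I (\<lambda>t. norm (f t) powr p)"
  unfolding window_integrable_def
proof (intro ballI allI)
  fix t l assume t: "t \<in> I"
  have sub: "{t..t+l} \<subseteq> I" using line_or_half_line(1)[OF I t] by auto
  have "(\<lambda>s. norm (f s)) \<in> borel_measurable (lebesgue_on I)"
    using line_or_half_line(3)[OF I] meas by (rule strongly_measurable_on_norm)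
  then have "(\<lambda>s. norm (f s) powr p) \<in> borel_measurable (lebesgue_on I)"
    by measurable
  then have "(\<lambda>s. norm (f s) powr p) \<in> borel_measurable (lebesgue_on {t..t+l})"
    using sub by (rule measurable_restrict_mono)
  then have "set_borel_measurable lebesgue {t..t+l} (\<lambda>s. norm (f s) powr p)"
    unfolding set_borel_measurable_def by (subst (asm) borel_measurable_restrict_space_iff) auto
  moreover have "set_integrable lebesgue {t..t+l} h"
    using h t by (simp add: window_integrable_def)
  moreover have "norm (norm (f s) powr p) \<le> norm (h s)" if "s \<in> {t..t+l}" for s
    using le[of s] sub that by auto
  ultimately show "set_integrable lebesgue {t..t+l} (\<lambda>s. norm (f s) powr p)"
    by - (rule set_integrable_bound[where f=h]; auto)
qed

lemma window_integrable_shift: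
  assumes "\<And>t. t \<in> I \<Longrightarrow> t + \<tau> \<in> I" "window_integrable I g"
  shows "window_integrable I (\<lambda>t. g (t + \<tau>))"
  using assms by (simp add: window_integrable_def set_integral_shift(2))

lemma Lp_loc_shift:
  assumes I: "I = UNIV \<or> I = {0..}" and "\<tau> \<in> I" "f \<in> Lp_loc p I"
  shows "(\<lambda>t. f (t + \<tau>)) \<in> Lp_loc p I"
proof (rule Lp_locI[OF I])
  have shift: "\<And>t. t \<in> I \<Longrightarrow> t + \<tau> \<in> I" using line_or_half_line(2)[OF I] assms(2) by blast
  show "strongly_measurable_on I (\<lambda>t. f (t + \<tau>))"
    using line_or_half_line(3)[OF I] shift assms(3)
    by (intro strongly_measurable_on_shift) (auto simp: Lp_loc_def)
  show "window_integrable I (\<lambda>t. norm (f (t + \<tau>)) powr p)"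
    using window_integrable_shift[OF shift Lp_loc_window_integrable[OF I assms(3)]] .
qed

lemma Lp_loc_diff:
  assumes I: "I = UNIV \<or> I = {0..}" and "0 < p" and f: "f \<in> Lp_loc p I" and g: "g \<in> Lp_loc p I"
  shows "(\<lambda>t. f t - g t) \<in> Lp_loc p I"
proof -
  have meas: "strongly_measurable_on I (\<lambda>t. f t - g t)"
    using f g by (auto simp: Lp_loc_def intro: strongly_measurable_on_diff)
  have "norm (f t - g t) powr p \<le> 4 powr p * (norm (f t) powr p + norm (g t) powr p)" for t
  proof -
    have "norm (f t - g t) powr p \<le> (norm (f t) + norm (g t) + 0 + 0) powr p"
      using \<open>0 < p\<close> by (intro powr_mono2) (auto intro: norm_triangle_ineq4)
    also have "\<dots> \<le> 4 powr p * (norm (f t) powr p + norm (g t) powr p + 0 powr p + 0 powr p)"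
      using \<open>0 < p\<close> by (intro powr_add4_le) auto
    finally show ?thesis by simp
  qed
  moreover have "window_integrable I (\<lambda>t. 4 powr p * (norm (f t) powr p + norm (g t) powr p))"
    by (intro window_integrable_intros Lp_loc_window_integrable[OF I] f g)
  ultimately show ?thesis
    by - (rule Lp_locI[OF I meas window_integrable_bound[OF I meas]])
qed

section \<open>Superposition\<close>

text \<open>The bound \<open>\<parallel>f(t, x(t))\<parallel> \<le> \<bar>L(t)\<bar> \<parallel>x(t)\<parallel> + 1 \<cdot> \<parallel>f(t, 0)\<parallel>\<close> exhibits two products of a locally
  \<open>r\<close>-integrable and a locally \<open>p\<close>-integrable factor; such products are locally \<open>q\<close>-integrable.\<close>

lemma superposition_in_Lp_loc:
  fixes f :: "real \<Rightarrow> 'y::banach \<Rightarrow> 'z::banach"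
  assumes I: "I = UNIV \<or> I = {0..}" and pqr: "0 < p" "0 < r" "q = p * r / (p + r)"
    and f: "\<And>u. (\<lambda>t. f t u) \<in> Lp_loc p I" and x: "x \<in> Lp_loc p I"
    and L: "window_integrable I (\<lambda>t. \<bar>L t\<bar> powr r)"
    and lip: "\<And>t u v. t \<in> I \<Longrightarrow> norm (f t u - f t v) \<le> \<bar>L t\<bar> * norm (u - v)"
  shows "(\<lambda>t. f t (x t)) \<in> Lp_loc q I"
proof -
  have "0 < q" using pqr by auto
  have "continuous_on UNIV (f t)" if "t \<in> I" for t
  proof (rule lipschitz_on_continuous_on)
    show "\<bar>L t\<bar>-lipschitz_on UNIV (f t)"
      using lip[OF that] by (auto simp: lipschitz_on_def dist_norm)
  qed
  then have meas: "strongly_measurable_on I (\<lambda>t. f t (x t))"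
    using f x by (intro strongly_measurable_on_superposition[where f=f and x=x]; simp add: Lp_loc_def)
  have "norm (f t (x t)) powr q \<le>
      4 powr q * (\<bar>L t\<bar> powr r + norm (x t) powr p + (1 + norm (f t 0) powr p))" if t: "t \<in> I" for t
  proof -
    have "norm (f t (x t)) \<le> norm (f t (x t) - f t 0) + norm (f t 0)"
      using norm_triangle_ineq[of "f t (x t) - f t 0" "f t 0"] by simp
    also have "\<dots> \<le> \<bar>L t\<bar> * norm (x t) + 1 * norm (f t 0) + 0 + 0"
      using lip[OF t, of "x t" 0] by simp
    finally have "norm (f t (x t)) powr q \<le> (\<bar>L t\<bar> * norm (x t) + 1 * norm (f t 0) + 0 + 0) powr q"
      using \<open>0 < q\<close> by (intro powr_mono2) auto
    also have "\<dots> \<le> 4 powr q * ((\<bar>L t\<bar> * norm (x t)) powr q + (1 * norm (f t 0)) powr q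
        + 0 powr q + 0 powr q)"
      using \<open>0 < q\<close> by (intro powr_add4_le) auto
    also have "\<dots> \<le> 4 powr q * (\<bar>L t\<bar> powr r + norm (x t) powr p + (1 + norm (f t 0) powr p))"
      using scaled_Young[OF pqr, of 1 "\<bar>L t\<bar>" "norm (x t)"]
        scaled_Young[OF pqr, of 1 1 "norm (f t 0)"]
      by (intro mult_left_mono) auto
    finally show ?thesis .
  qed
  moreover have "window_integrable I
      (\<lambda>t. 4 powr q * (\<bar>L t\<bar> powr r + norm (x t) powr p + (1 + norm (f t 0) powr p)))"
    by (intro window_integrable_intros Lp_loc_window_integrable[OF I] f x L)
  ultimately show ?thesis
    by - (rule Lp_locI[OF I meas window_integrable_bound[OF I meas]])
qed

text \<open>Here \<open>y = x(t)\<close>, \<open>t' = t + \<tau>\<close>, \<open>y' = x(t')\<close>, and \<open>u\<close> is a point of the finite net \<open>U\<close> close to \<open>y\<close>.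
  The path \<open>f(t', y')\<close>, \<open>f(t', y)\<close>, \<open>f(t', u)\<close>, \<open>f(t, u)\<close>, \<open>f(t, y)\<close> changes \<open>t\<close> only at the net
  point \<open>u\<close>; its other steps are controlled by the Lipschitz bounds. Which \<open>u\<close> is used depends on
  \<open>t\<close>, so the change at \<open>u\<close> is bounded by the sum over the whole net, where no choice appears.\<close>

lemma superposition_shift_pointwise:
  fixes f :: "real \<Rightarrow> 'y::banach \<Rightarrow> 'z::banach"
  assumes pqr: "0 < p" "0 < r" "q = p * r / (p + r)" and "0 < \<eta>" "finite U" "u \<in> U"
    and near: "norm (y - u) \<le> \<delta>"
    and lip: "\<And>u v. norm (f t u - f t v) \<le> \<bar>a\<bar> * norm (u - v)"
      "\<And>u v. norm (f t' u - f t' v) \<le> \<bar>b\<bar> * norm (u - v)"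
  shows "norm (f t' y' - f t y) powr q \<le> 4 powr q *
    (\<eta> powr r * (2 * \<bar>b\<bar> powr r + \<bar>a\<bar> powr r + 1) +
     \<eta> powr (-p) * (norm (y' - y) powr p + (\<Sum>v\<in>U. norm (f t' v - f t v) powr p) + 2 * \<delta> powr p))"
proof -
  have "0 < q" "0 \<le> \<delta>" using pqr order_trans[OF norm_ge_zero near] by auto
  define g where "g = norm (f t' u - f t u)"
  have "f t' y' - f t y = (f t' y' - f t' y) + (f t' y - f t' u) + (f t' u - f t u) + (f t u - f t y)"
    by simp
  then have "norm (f t' y' - f t y) \<le>
      norm (f t' y' - f t' y) + norm (f t' y - f t' u) + g + norm (f t u - f t y)"
    unfolding g_def by (metis add_mono norm_triangle_ineq norm_triangle_le order_refl)
  moreover have "norm (f t' y' - f t' y) \<le> \<bar>b\<bar> * norm (y' - y)" by (rule lip)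
  moreover have "norm (f t' y - f t' u) \<le> \<bar>b\<bar> * \<delta>"
    using lip(2)[of y u] mult_left_mono[OF near, of "\<bar>b\<bar>"] by linarith
  moreover have "norm (f t u - f t y) \<le> \<bar>a\<bar> * \<delta>"
    using lip(1)[of u y] mult_left_mono[OF near, of "\<bar>a\<bar>"] by (simp add: norm_minus_commute)
  ultimately have "norm (f t' y' - f t y) \<le> \<bar>b\<bar> * norm (y' - y) + \<bar>b\<bar> * \<delta> + 1 * g + \<bar>a\<bar> * \<delta>"
    by linarith
  then have "norm (f t' y' - f t y) powr q \<le>
      (\<bar>b\<bar> * norm (y' - y) + \<bar>b\<bar> * \<delta> + 1 * g + \<bar>a\<bar> * \<delta>) powr q"
    using \<open>0 < q\<close> by (intro powr_mono2) auto
  also have "\<dots> \<le> 4 powr q * ((\<bar>b\<bar> * norm (y' - y)) powr q + (\<bar>b\<bar> * \<delta>) powr q + (1 * g) powr q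
      + (\<bar>a\<bar> * \<delta>) powr q)"
    using \<open>0 < q\<close> \<open>0 \<le> \<delta>\<close> by (intro powr_add4_le) (auto simp: g_def)
  also have "\<dots> \<le> 4 powr q *
      ((\<eta> powr r * \<bar>b\<bar> powr r + \<eta> powr (-p) * norm (y' - y) powr p)
       + (\<eta> powr r * \<bar>b\<bar> powr r + \<eta> powr (-p) * \<delta> powr p)
       + (\<eta> powr r * 1 powr r + \<eta> powr (-p) * (\<Sum>v\<in>U. norm (f t' v - f t v) powr p))
       + (\<eta> powr r * \<bar>a\<bar> powr r + \<eta> powr (-p) * \<delta> powr p))"
  proof (intro mult_left_mono add_mono scaled_Young[OF pqr \<open>0 < \<eta>\<close>])
    have "g powr p \<le> (\<Sum>v\<in>U. norm (f t' v - f t v) powr p)"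
      unfolding g_def using assms(5,6)
      by (intro member_le_sum[where f="\<lambda>v. norm (f t' v - f t v) powr p"]) auto
    then have "\<eta> powr r * 1 powr r + \<eta> powr (-p) * g powr p \<le>
        \<eta> powr r * 1 powr r + \<eta> powr (-p) * (\<Sum>v\<in>U. norm (f t' v - f t v) powr p)"
      by (intro add_left_mono mult_left_mono) auto
    then show "(1 * g) powr q \<le>
        \<eta> powr r * 1 powr r + \<eta> powr (-p) * (\<Sum>v\<in>U. norm (f t' v - f t v) powr p)"
      using scaled_Young[OF pqr \<open>0 < \<eta>\<close>, of 1 g] by (simp add: g_def)
  qed (use \<open>0 \<le> \<delta>\<close> in auto)
  finally show ?thesis by (simp add: algebra_simps)
qed

text \<open>The distance between \<open>f\<close> and its translate is uniform in \<open>u \<in> K\<close>, but for a constant \<open>u\<close>, whereas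
  \<open>x(t)\<close> moves through \<open>K\<close> inside the integral. A finite \<open>\<delta>\<close>-net of \<open>K\<close> bridges the gap. The
  parameters must be chosen in the order \<open>\<eta>\<close>, \<open>\<delta>\<close>, \<open>\<epsilon>'\<close>: the weight \<open>\<eta>\<^sup>-\<^sup>p\<close> multiplies
  \<open>\<delta>\<^sup>p\<close>, and the size of the net, determined by \<open>\<delta>\<close>, multiplies \<open>\<epsilon>'\<^sup>p\<close>.
  The conclusion is for windows of length \<open>max 1 l\<close> because the means of \<open>\<bar>L\<bar>\<^sup>r\<close> over windows of
  length \<open>l\<close> are known to be uniformly bounded only when \<open>l\<close> stays away from \<open>0\<close>.\<close>

lemma superposition_shift_estimate:
  fixes f :: "real \<Rightarrow> 'y::banach \<Rightarrow> 'z::banach"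
  assumes I: "I = UNIV \<or> I = {0..}" and p: "1 \<le> p" and r: "0 < r" and q: "q = p * r / (p + r)"
    and f: "\<And>u. (\<lambda>t. f t u) \<in> Lp_loc p I" and x: "x \<in> Lp_loc p I"
    and L: "window_integrable I (\<lambda>t. \<bar>L t\<bar> powr r)"
    and M: "\<And>t. t \<in> I \<Longrightarrow> (LINT s:{t..t+1}|lebesgue. \<bar>L s\<bar> powr r) \<le> M"
    and lip: "\<And>t u v. t \<in> I \<Longrightarrow> norm (f t u - f t v) \<le> \<bar>L t\<bar> * norm (u - v)"
    and E: "E \<in> null_sets lebesgue" and xK: "\<And>t. t \<in> I - E \<Longrightarrow> x t \<in> K"
    and K: "compact (closure K)" and "0 < \<epsilon>"
  obtains \<epsilon>' where "0 < \<epsilon>'"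
    "\<And>\<tau> l. \<tau> \<in> I \<Longrightarrow> 0 < l \<Longrightarrow> weyl_shift_dist p l I K \<tau> f \<le> ennreal \<epsilon>' \<Longrightarrow>
      weyl_dist p l I (\<lambda>s. x (s + \<tau>)) x \<le> ennreal \<epsilon>' \<Longrightarrow>
      weyl_dist q (max 1 l) I (\<lambda>t. f (t + \<tau>) (x (t + \<tau>))) (\<lambda>t. f t (x t)) \<le> ennreal \<epsilon>"
proof -
  have "0 < p" "0 < q" using p r q by auto
  obtain t0 where "t0 \<in> I" using line_or_half_line(4)[OF I] by auto
  have "0 \<le> (LINT s:{t0..t0+1}|lebesgue. \<bar>L s\<bar> powr r)" by (simp add: set_lebesgue_integral_def)
  then have "0 \<le> M" using M[OF \<open>t0 \<in> I\<close>] by linarith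
  define c where "c = (4::real) powr q"
  have "0 < c" by (simp add: c_def)
  \<comment> \<open>The budget \<open>\<epsilon>\<^sup>q\<close> is split among the terms governed by \<open>\<eta>\<close>, \<open>\<delta>\<close> and \<open>\<epsilon>'\<close>.\<close>
  define B where "B = \<epsilon> powr q / 3"
  have "0 < B" using \<open>0 < \<epsilon>\<close> by (simp add: B_def)
  obtain \<eta> where \<eta>: "0 < \<eta>" "c * (6 * M + 1) * \<eta> powr r \<le> B"
    using small_powr_exists[of "c * (6 * M + 1)" B r] \<open>0 \<le> M\<close> \<open>0 < c\<close> \<open>0 < B\<close> r by auto
  define k where "k = \<eta> powr (-p)"
  have "0 < k" using \<eta> by (simp add: k_def)
  obtain \<delta> where \<delta>: "0 < \<delta>" "2 * c * k * \<delta> powr p \<le> B"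
    using small_powr_exists[of "2 * c * k" B p] \<open>0 < k\<close> \<open>0 < c\<close> \<open>0 < B\<close> \<open>0 < p\<close> by auto
  have cover: "closure K \<subseteq> (\<Union>u\<in>K. ball u \<delta>)"
    using \<open>0 < \<delta>\<close> by (auto simp: closure_approachable dist_commute)
  obtain U where U: "U \<subseteq> K" "finite U" "closure K \<subseteq> (\<Union>u\<in>U. ball u \<delta>)"
    by (rule compactE_image[OF K, of K "\<lambda>u. ball u \<delta>", OF open_ball cover])
  obtain \<epsilon>1 where \<epsilon>1: "0 < \<epsilon>1" "c * k * (real (card U) + 1) * \<epsilon>1 powr p \<le> B"
    using small_powr_exists[of "c * k * (real (card U) + 1)" B p] \<open>0 < k\<close> \<open>0 < c\<close> \<open>0 < B\<close> \<open>0 < p\<close>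
    by auto
  show thesis
  proof (rule that)
    \<comment> \<open>Enlarging the windows from \<open>l\<close> to \<open>max 1 l\<close> costs a factor \<open>2\<close>, hence the halving.\<close>
    show "0 < \<epsilon>1 / 2" using \<epsilon>1 by simp
    fix \<tau> l assume \<tau>: "\<tau> \<in> I" and "0 < l"
      and fd: "weyl_shift_dist p l I K \<tau> f \<le> ennreal (\<epsilon>1 / 2)"
      and xd: "weyl_dist p l I (\<lambda>s. x (s + \<tau>)) x \<le> ennreal (\<epsilon>1 / 2)"
    define m where "m = max 1 l"
    have m: "1 \<le> m" "l \<le> m" by (auto simp: m_def)
    have shift: "\<And>t. t \<in> I \<Longrightarrow> t + \<tau> \<in> I" using line_or_half_line(2)[OF I] \<tau> by blast
    have window: "(LINT s:{t..t+m}|lebesgue. norm (\<phi> s - \<psi> s) powr p) \<le> m * \<epsilon>1 powr p"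
      if t: "t \<in> I" and d: "weyl_dist p l I \<phi> \<psi> \<le> ennreal (\<epsilon>1 / 2)"
        and int: "window_integrable I (\<lambda>s. norm (\<phi> s - \<psi> s) powr p)"
      for t and \<phi> \<psi> :: "real \<Rightarrow> 'b::banach"
    proof -
      have "(1 + l / m) powr (1 / p) \<le> 2 powr 1"
        using m p \<open>0 < l\<close>
        by (intro powr_mono_both) (auto simp: field_simps)
      then have two: "ennreal ((1 + l / m) powr (1 / p)) \<le> ennreal 2" by (intro ennreal_leI) simp
      have "weyl_dist p m I \<phi> \<psi> \<le> ennreal ((1 + l / m) powr (1 / p)) * weyl_dist p l I \<phi> \<psi>"
        using m \<open>0 < l\<close> \<open>0 < p\<close> by (intro weyl_dist_window_change[OF I _ _ _ int]) auto
      also have "\<dots> \<le> ennreal 2 * ennreal (\<epsilon>1 / 2)"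
        using two d by (intro mult_mono) auto
      also have "\<dots> = ennreal \<epsilon>1" using \<epsilon>1 by (subst ennreal_mult[symmetric]) auto
      finally show ?thesis using weyl_dist_le_iff[of p m \<epsilon>1 I \<phi> \<psi>] m \<open>0 < p\<close> \<epsilon>1 t by auto
    qed
    define a where "a s = \<bar>L s\<bar> powr r" for s
    define b where "b s = \<bar>L (s + \<tau>)\<bar> powr r" for s
    define d where "d s = norm (x (s + \<tau>) - x s) powr p" for s
    define g where "g v s = norm (f (s + \<tau>) v - f s v) powr p" for v s
    define H where "H s = c * (\<eta> powr r * (2 * b s + a s + 1) +
        k * (d s + (\<Sum>v\<in>U. g v s) + 2 * \<delta> powr p))" for s
    have a_int: "window_integrable I a" using L by (simp add: a_def[abs_def])
    have b_int: "window_integrable I b"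
      using window_integrable_shift[OF shift L] by (simp add: b_def[abs_def])
    have d_int: "window_integrable I d" unfolding d_def
      by (intro Lp_loc_window_integrable[OF I] Lp_loc_diff[OF I \<open>0 < p\<close>] Lp_loc_shift[OF I \<tau>] x)
    have g_int: "window_integrable I (g v)" for v unfolding g_def
      by (intro Lp_loc_window_integrable[OF I] Lp_loc_diff[OF I \<open>0 < p\<close>]
          Lp_loc_shift[OF I \<tau>, of "\<lambda>t. f t v"] f)
    have H_int: "window_integrable I H"
      unfolding H_def by (intro window_integrable_intros a_int b_int d_int g_int)
    have "(LINT s:{t..t+m}|lebesgue. norm (f (s + \<tau>) (x (s + \<tau>)) - f s (x s)) powr q)
        \<le> m * \<epsilon> powr q" if t: "t \<in> I" for t
    proof -
      let ?W = "{t..t+m}"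
      have sub: "?W \<subseteq> I" using line_or_half_line(1)[OF I t] by auto
      have le: "norm (f (s + \<tau>) (x (s + \<tau>)) - f s (x s)) powr q \<le> H s"
        if s: "s \<in> ?W" "s \<notin> E" for s
      proof -
        have "s \<in> I" using s sub by auto
        then have "x s \<in> closure K" using xK s closure_subset[of K] by auto
        then obtain u where "u \<in> U" "norm (x s - u) \<le> \<delta>"
          using U(3) by (force simp: dist_norm norm_minus_commute)
        then show ?thesis
          unfolding H_def a_def b_def d_def g_def c_def k_def
          by (rule superposition_shift_pointwise[OF \<open>0 < p\<close> r q \<open>0 < \<eta>\<close> \<open>finite U\<close>])
            (use lip \<open>s \<in> I\<close> shift in auto)
      qed
      have "(LINT s:?W|lebesgue. norm (f (s + \<tau>) (x (s + \<tau>)) - f s (x s)) powr q)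
          \<le> (LINT s:?W|lebesgue. H s)"
        unfolding set_lebesgue_integral_def
      proof (rule integral_mono_AE')
        show "integrable lebesgue (\<lambda>s. indicator ?W s *\<^sub>R H s)"
          using H_int t by (simp add: window_integrable_def set_integrable_def)
        show "AE s in lebesgue. indicator ?W s *\<^sub>R norm (f (s + \<tau>) (x (s + \<tau>)) - f s (x s)) powr q
            \<le> indicator ?W s *\<^sub>R H s"
          using AE_not_in[OF E] by eventually_elim (auto simp: indicator_def le)
        show "AE s in lebesgue. 0 \<le> indicator ?W s *\<^sub>R H s"
          using \<open>0 < c\<close> \<open>0 < k\<close>
          by (auto simp: H_def a_def b_def d_def g_def intro!: mult_nonneg_nonneg add_nonneg_nonneg sum_nonneg)
      qed
      also have "\<dots> = c * (\<eta> powr r * (2 * (LINT s:?W|lebesgue. b s) + (LINT s:?W|lebesgue. a s) + m)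
          + k * ((LINT s:?W|lebesgue. d s) + (\<Sum>v\<in>U. LINT s:?W|lebesgue. g v s) + 2 * \<delta> powr p * m))"
      proof -
        have one: "(LINT s:?W|lebesgue. C) = C * m" for C :: real
          using m by (simp add: set_lebesgue_integral_def)
        have int: "set_integrable lebesgue ?W \<phi>" if "window_integrable I \<phi>" for \<phi>
          using that t by (simp add: window_integrable_def)
        have sum: "(LINT s:?W|lebesgue. \<Sum>v\<in>U. g v s) = (\<Sum>v\<in>U. LINT s:?W|lebesgue. g v s)"
          using int[OF g_int] unfolding set_lebesgue_integral_def scaleR_sum_right set_integrable_def
          by (intro Bochner_Integration.integral_sum)
        show ?thesis
          unfolding H_def
          by (subst set_integral_mult_right set_integral_add(2) sum one |
              rule int window_integrable_intros a_int b_int d_int g_int | simp)+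
      qed
      also have "\<dots> \<le> c * (\<eta> powr r * (2 * (2 * m * M) + 2 * m * M + m)
          + k * (m * \<epsilon>1 powr p + (\<Sum>v\<in>U. m * \<epsilon>1 powr p) + 2 * \<delta> powr p * m))"
      proof -
        have LM: "(LINT s:{t..t+m}|lebesgue. \<bar>L s\<bar> powr r) \<le> 2 * m * M" if "t \<in> I" for t
        proof -
          have "(LINT s:{t..t+m}|lebesgue. \<bar>L s\<bar> powr r) \<le> (m / 1 + 1) * M"
            using m that by (intro window_integral_le[OF I L] M) auto
          also have "\<dots> \<le> 2 * m * M" using m \<open>0 \<le> M\<close> by (intro mult_right_mono) auto
          finally show ?thesis .
        qed
        have "(LINT s:?W|lebesgue. a s) \<le> 2 * m * M" using LM[OF t] by (simp add: a_def)
        moreover have "(LINT s:?W|lebesgue. b s) \<le> 2 * m * M"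
          using LM[OF shift[OF t]] set_integral_shift(1)[where g="\<lambda>s. \<bar>L s\<bar> powr r"]
          by (simp add: b_def)
        moreover have "(LINT s:?W|lebesgue. d s) \<le> m * \<epsilon>1 powr p"
          using window[OF t xd] d_int by (simp add: d_def[abs_def])
        moreover have "(LINT s:?W|lebesgue. g v s) \<le> m * \<epsilon>1 powr p" if "v \<in> U" for v
        proof -
          have "weyl_dist p l I (\<lambda>t. f (t + \<tau>) v) (\<lambda>t. f t v) \<le> ennreal (\<epsilon>1 / 2)"
            using fd U(1) that unfolding weyl_shift_dist_def by (meson SUP_le_iff subsetD)
          then show ?thesis using window[OF t] g_int[of v] by (simp add: g_def[abs_def])
        qed
        ultimately show ?thesis
          using \<open>0 < c\<close> \<open>0 < k\<close> by (intro mult_left_mono add_mono sum_mono) auto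
      qed
      also have "\<dots> = m * (c * (6 * M + 1) * \<eta> powr r + 2 * c * k * \<delta> powr p
          + c * k * (real (card U) + 1) * \<epsilon>1 powr p)"
        by (simp add: algebra_simps)
      also have "\<dots> \<le> m * (B + B + B)"
        using m \<eta>(2) \<delta>(2) \<epsilon>1(2) by (intro mult_left_mono add_mono) auto
      also have "\<dots> = m * \<epsilon> powr q" by (simp add: B_def)
      finally show ?thesis .
    qed
    then show "weyl_dist q (max 1 l) I (\<lambda>t. f (t + \<tau>) (x (t + \<tau>))) (\<lambda>t. f t (x t)) \<le> ennreal \<epsilon>"
      unfolding m_def[symmetric] using m \<open>0 < q\<close> \<open>0 < \<epsilon>\<close> by (subst weyl_dist_le_iff) auto
  qed
qed

section \<open>Weyl almost periodicity of the superposition\<close>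

theorem theorem2p3:
  fixes f :: "real \<Rightarrow> 'y::complex_banach \<Rightarrow> 'x::complex_banach"
    and x :: "real \<Rightarrow> 'y"
    and Lf :: "real \<Rightarrow> real"
    and I E :: "real set"
    and K :: "'y set"
    and p q r :: real
  assumes nontrivial_X: "\<exists>v::'x. v \<noteq> 0"
    and nontrivial_Y: "\<exists>u::'y. u \<noteq> 0"
    and I: "I = UNIV \<or> I = {0..}"
    and p: "1 < p"
    and r: "r \<ge> max p (p / (p - 1))"
    and Lf: "(\<lambda>t. complex_of_real (Lf t)) \<in> stepanov r I"
    and lipschitz: "\<forall>t\<in>I. \<forall>u v. norm (f t u - f t v) \<le> Lf t * norm (u - v)"
    and E: "E \<subseteq> I" "E \<in> null_sets lebesgue"
    and K: "K = {x t | t. t \<in> I - E}" "compact (closure K)"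
    and q: "q = p * r / (p + r)"
  shows
    "(f \<in> equi_weyl_ap_compact p I \<and> x \<in> equi_weyl_ap p I \<and>
      (\<forall>\<epsilon>>0. \<exists>l>0. \<exists>L>0. \<forall>J. interval_of_length L J \<and> J \<subseteq> I \<longrightarrow>
        (\<exists>\<tau>\<in>J. weyl_shift_dist p l I K \<tau> f \<le> ennreal \<epsilon> \<and>
               weyl_dist p l I (\<lambda>s. x (s + \<tau>)) x \<le> ennreal \<epsilon>))
      \<longrightarrow> q \<in> {1..<p} \<and> (\<lambda>t. f t (x t)) \<in> equi_weyl_ap q I)
     \<and>
     (f \<in> weyl_ap_compact p I \<and> x \<in> weyl_ap p I \<and>
      (\<forall>\<epsilon>>0. \<exists>L>0. \<forall>J. interval_of_length L J \<and> J \<subseteq> I \<longrightarrow>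
        (\<exists>\<tau>\<in>J. \<exists>l0>0. \<forall>l\<ge>l0. weyl_shift_dist p l I K \<tau> f \<le> ennreal \<epsilon> \<and>
               weyl_dist p l I (\<lambda>s. x (s + \<tau>)) x \<le> ennreal \<epsilon>))
      \<longrightarrow> q \<in> {1..<p} \<and> (\<lambda>t. f t (x t)) \<in> weyl_ap q I)"
proof -
  have "0 < p" using p by simp
  have rp: "p \<le> r" "p / (p - 1) \<le> r" using r by auto
  have "0 < r" using rp p by linarith
  have "p \<le> r * (p - 1)" using rp(2) p by (simp add: pos_divide_le_eq)
  then have q_range: "q \<in> {1..<p}"
    using p \<open>0 < r\<close> unfolding q by (auto simp: field_simps)
  then have "0 < q" by auto
  \<comment> \<open>A nonzero vector forces the Lipschitz factor to be nonnegative.\<close>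
  obtain v :: 'y where "v \<noteq> 0" using nontrivial_Y by blast
  have Lf_nonneg: "0 \<le> Lf t" if "t \<in> I" for t
  proof -
    have "0 \<le> Lf t * norm (v - 0)"
      using lipschitz that norm_ge_zero order_trans by blast
    then show ?thesis using \<open>v \<noteq> 0\<close> by (simp add: zero_le_mult_iff)
  qed
  have lip: "norm (f t u - f t w) \<le> \<bar>Lf t\<bar> * norm (u - w)" if "t \<in> I" for t u w
    using lipschitz Lf_nonneg[OF that] that by simp
  have Lf_int: "window_integrable I (\<lambda>t. \<bar>Lf t\<bar> powr r)"
    using Lp_loc_window_integrable[OF I, of "\<lambda>t. complex_of_real (Lf t)" r] Lf
    by (simp add: stepanov_def)
  define S where "S = (SUP t\<in>I. ennreal ((LINT s:{t..t+1}|lebesgue. \<bar>Lf s\<bar> powr r) powr (1 / r)))"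
  have "S < \<infinity>" using Lf by (simp add: stepanov_def S_def)
  have M: "(LINT s:{t..t+1}|lebesgue. \<bar>Lf s\<bar> powr r) \<le> enn2real S powr r" if "t \<in> I" for t
  proof -
    let ?J = "LINT s:{t..t+1}|lebesgue. \<bar>Lf s\<bar> powr r"
    have "0 \<le> ?J" by (simp add: set_lebesgue_integral_def)
    have "ennreal (?J powr (1 / r)) \<le> ennreal (enn2real S)"
      using \<open>S < \<infinity>\<close> that unfolding S_def by (subst ennreal_enn2real) (auto intro: SUP_upper)
    then have "?J powr (1 / r) \<le> enn2real S" by simp
    then have "(?J powr (1 / r)) powr r \<le> enn2real S powr r"
      using \<open>0 < r\<close> by (intro powr_mono2) auto
    then show ?thesis using \<open>0 \<le> ?J\<close> \<open>0 < r\<close> by (simp add: powr_powr)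
  qed
  have xK: "x t \<in> K" if "t \<in> I - E" for t using K(1) that by blast
  let ?F = "\<lambda>t. f t (x t)"
  note superposition = superposition_in_Lp_loc[OF I \<open>0 < p\<close> \<open>0 < r\<close> q _ _ Lf_int lip]
  have estimate: "\<exists>\<epsilon>'>0. \<forall>\<tau>\<in>I. \<forall>l>0. weyl_shift_dist p l I K \<tau> f \<le> ennreal \<epsilon>' \<longrightarrow>
      weyl_dist p l I (\<lambda>s. x (s + \<tau>)) x \<le> ennreal \<epsilon>' \<longrightarrow>
      weyl_dist q (max 1 l) I (\<lambda>t. ?F (t + \<tau>)) ?F \<le> ennreal \<epsilon>"
    if f: "\<And>u. (\<lambda>t. f t u) \<in> Lp_loc p I" and x: "x \<in> Lp_loc p I" and "0 < \<epsilon>" for \<epsilon>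
    by (rule superposition_shift_estimate[OF I less_imp_le[OF p] \<open>0 < r\<close> q f x Lf_int M lip
        E(2) xK K(2) \<open>0 < \<epsilon>\<close>]) blast+
  show ?thesis
  proof (intro conjI impI; (elim conjE)?)
    assume "f \<in> equi_weyl_ap_compact p I" "x \<in> equi_weyl_ap p I"
      and common: "\<forall>\<epsilon>>0. \<exists>l>0. \<exists>L>0. \<forall>J. interval_of_length L J \<and> J \<subseteq> I \<longrightarrow>
        (\<exists>\<tau>\<in>J. weyl_shift_dist p l I K \<tau> f \<le> ennreal \<epsilon> \<and>
               weyl_dist p l I (\<lambda>s. x (s + \<tau>)) x \<le> ennreal \<epsilon>)"
    then have f: "\<And>u. (\<lambda>t. f t u) \<in> Lp_loc p I" and x: "x \<in> Lp_loc p I"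
      by (auto simp: equi_weyl_ap_compact_def equi_weyl_ap_def)
    show "q \<in> {1..<p}" by (rule q_range)
    show "?F \<in> equi_weyl_ap q I"
      unfolding equi_weyl_ap_def
    proof (intro CollectI conjI allI impI)
      show "?F \<in> Lp_loc q I"
        using f x by (rule superposition)
      fix \<epsilon> :: real assume "0 < \<epsilon>"
      from estimate[OF f x this] obtain \<epsilon>' where "0 < \<epsilon>'" and est: "\<And>\<tau> l. \<tau> \<in> I \<Longrightarrow> 0 < l \<Longrightarrow>
          weyl_shift_dist p l I K \<tau> f \<le> ennreal \<epsilon>' \<Longrightarrow>
          weyl_dist p l I (\<lambda>s. x (s + \<tau>)) x \<le> ennreal \<epsilon>' \<Longrightarrow>
          weyl_dist q (max 1 l) I (\<lambda>t. ?F (t + \<tau>)) ?F \<le> ennreal \<epsilon>"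
        by blast
      from common[rule_format, OF \<open>0 < \<epsilon>'\<close>] obtain l L where "0 < l" "0 < L"
        and \<tau>: "\<And>J. interval_of_length L J \<Longrightarrow> J \<subseteq> I \<Longrightarrow>
          \<exists>\<tau>\<in>J. weyl_shift_dist p l I K \<tau> f \<le> ennreal \<epsilon>' \<and>
               weyl_dist p l I (\<lambda>s. x (s + \<tau>)) x \<le> ennreal \<epsilon>'"
        by blast
      have "\<exists>\<tau>\<in>J. weyl_dist q (max 1 l) I (\<lambda>t. ?F (t + \<tau>)) ?F \<le> ennreal \<epsilon>"
        if "interval_of_length L J" "J \<subseteq> I" for J
        using \<tau>[OF that] est \<open>0 < l\<close> that(2) by (meson subsetD)
      moreover have "0 < max 1 l" by simp
      ultimately show "\<exists>l>0. \<exists>L>0. \<forall>J. interval_of_length L J \<and> J \<subseteq> I \<longrightarrow>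
          (\<exists>\<tau>\<in>J. weyl_dist q l I (\<lambda>t. ?F (t + \<tau>)) ?F \<le> ennreal \<epsilon>)"
        using \<open>0 < L\<close> by blast
    qed
  next
    assume "f \<in> weyl_ap_compact p I" "x \<in> weyl_ap p I"
      and common: "\<forall>\<epsilon>>0. \<exists>L>0. \<forall>J. interval_of_length L J \<and> J \<subseteq> I \<longrightarrow>
        (\<exists>\<tau>\<in>J. \<exists>l0>0. \<forall>l\<ge>l0. weyl_shift_dist p l I K \<tau> f \<le> ennreal \<epsilon> \<and>
               weyl_dist p l I (\<lambda>s. x (s + \<tau>)) x \<le> ennreal \<epsilon>)"
    then have f: "\<And>u. (\<lambda>t. f t u) \<in> Lp_loc p I" and x: "x \<in> Lp_loc p I"
      by (auto simp: weyl_ap_compact_def weyl_ap_def)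
    show "q \<in> {1..<p}" by (rule q_range)
    have F: "?F \<in> Lp_loc q I"
      using f x by (rule superposition)
    show "?F \<in> weyl_ap q I"
      unfolding weyl_ap_def
    proof (intro CollectI conjI allI impI)
      show "?F \<in> Lp_loc q I" by (rule F)
      fix \<epsilon> :: real assume "0 < \<epsilon>"
      from estimate[OF f x this] obtain \<epsilon>' where "0 < \<epsilon>'" and est: "\<And>\<tau> l. \<tau> \<in> I \<Longrightarrow> 0 < l \<Longrightarrow>
          weyl_shift_dist p l I K \<tau> f \<le> ennreal \<epsilon>' \<Longrightarrow>
          weyl_dist p l I (\<lambda>s. x (s + \<tau>)) x \<le> ennreal \<epsilon>' \<Longrightarrow>
          weyl_dist q (max 1 l) I (\<lambda>t. ?F (t + \<tau>)) ?F \<le> ennreal \<epsilon>"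
        by blast
      from common[rule_format, OF \<open>0 < \<epsilon>'\<close>] obtain L where "0 < L"
        and \<tau>: "\<And>J. interval_of_length L J \<Longrightarrow> J \<subseteq> I \<Longrightarrow>
          \<exists>\<tau>\<in>J. \<exists>l0>0. \<forall>l\<ge>l0. weyl_shift_dist p l I K \<tau> f \<le> ennreal \<epsilon>' \<and>
               weyl_dist p l I (\<lambda>s. x (s + \<tau>)) x \<le> ennreal \<epsilon>'"
        by blast
      have "\<exists>\<tau>\<in>J. \<exists>d. ((\<lambda>l. weyl_dist q l I (\<lambda>t. ?F (t + \<tau>)) ?F) \<longlongrightarrow> d) at_top \<and> d \<le> ennreal \<epsilon>"
        if J: "interval_of_length L J" "J \<subseteq> I" for J
      proof -
        \<comment> \<open>A single window length is enough, as the limit is the infimum over all of them.\<close>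
        from \<tau>[OF J] obtain \<tau> l where "\<tau> \<in> J" "0 < l"
          and "weyl_shift_dist p l I K \<tau> f \<le> ennreal \<epsilon>'"
            "weyl_dist p l I (\<lambda>s. x (s + \<tau>)) x \<le> ennreal \<epsilon>'"
          by blast
        moreover from \<open>\<tau> \<in> J\<close> have "\<tau> \<in> I" using J by blast
        ultimately have "weyl_dist q (max 1 l) I (\<lambda>t. ?F (t + \<tau>)) ?F \<le> ennreal \<epsilon>"
          by (intro est)
        then have "(INF h\<in>{0<..}. weyl_dist q h I (\<lambda>t. ?F (t + \<tau>)) ?F) \<le> ennreal \<epsilon>"
          by (rule INF_lower2[rotated]) simp
        moreover have "((\<lambda>l. weyl_dist q l I (\<lambda>t. ?F (t + \<tau>)) ?F) \<longlongrightarrow>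
            (INF h\<in>{0<..}. weyl_dist q h I (\<lambda>t. ?F (t + \<tau>)) ?F)) at_top"
          by (intro weyl_dist_tendsto[OF I \<open>0 < q\<close>] Lp_loc_window_integrable[OF I]
              Lp_loc_diff[OF I \<open>0 < q\<close>] Lp_loc_shift[OF I \<open>\<tau> \<in> I\<close> F] F)
        ultimately show ?thesis using \<open>\<tau> \<in> J\<close> by blast
      qed
      then show "\<exists>L>0. \<forall>J. interval_of_length L J \<and> J \<subseteq> I \<longrightarrow> (\<exists>\<tau>\<in>J. \<exists>d.
          ((\<lambda>l. weyl_dist q l I (\<lambda>t. ?F (t + \<tau>)) ?F) \<longlongrightarrow> d) at_top \<and> d \<le> ennreal \<epsilon>)"
        using \<open>0 < L\<close> by blast
    qed
  qed
qed

end
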